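(* Let $K$ be a finite extension of $\mathbb{Q}$ with ring of integers $\mathcal{O}_K$, and let $\mathfrak{B}$ be a primitive collection of non-zero ideals in $\mathcal{O}_K$ such that $\mathfrak{D}=\emptyset$. Let $r\in\mathcal{O}_K$ and let $\mathfrak{a}\subseteq\mathcal{O}_K$ be an ideal. If $$r+\mathfrak{a}\subseteq\mathcal{M}_{\mathfrak{B}},$$ then for some $\mathfrak{b}\in\mathfrak{B}$ $$\gcd((r),\mathfrak{a})=(r)+\mathfrak{a}\subseteq\mathfrak{b}.$$
   Context: A collection of ideals is primitive if $\mathfrak{b}\subseteq\mathfrak{b}'$ for members $\mathfrak{b},\mathfrak{b}'$ implies $\mathfrak{b}=\mathfrak{b}'$. $\mathcal{M}_{\mathfrak{B}}=\bigcup_{\mathfrak{b}\in\mathfrak{B}}\mathfrak{b}$. $(r)=r\mathcal{O}_K$, and $\gcd$ of two ideals denotes their sum. A collection $\mathcal{C}$ of ideals is pairwise coprime if $\mathfrak{c}+\mathfrak{c}'=\mathcal{O}_K$ for all distinct $\mathfrak{c},\mathfrak{c}'\in\mathcal{C}$. $\mathfrak{D}$ is the set of all non-zero ideals $\mathfrak{d}\subseteq\mathcal{O}_K$ (possibly $\mathfrak{d}=\mathcal{O}_K$) such that $\{\mathfrak{d}\mathfrak{c}:\mathfrak{c}\in\mathcal{C}\}\subseteq\mathfrak{B}$ for some infinite pairwise coprime collection $\mathcal{C}$ of ideals in $\mathcal{O}_K$. *)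

theory Defs
  imports
    "HOL-Computational_Algebra.Polynomial"
    "HOL-Algebra.Ideal_Product"
begin

(* Every number field is, up to isomorphism, a type of class field_char_0 satisfying this
   predicate; the rationals act through the canonical embedding of_rat. *)
definition number_field :: "'k::field_char_0 itself \<Rightarrow> bool" where
  "number_field _ \<longleftrightarrow>
     (\<exists>Basis. finite_dimensional_vector_space (\<lambda>(q::rat) (x::'k). of_rat q * x) Basis)"

definition ring_of_integers :: "'k::field_char_0 ring" where
  "ring_of_integers =
     \<lparr>carrier = {x. algebraic_int x}, mult = (*), one = 1, zero = 0, add = (+)\<rparr>"

definition primitive_collection :: "'a set set \<Rightarrow> bool" where
  "primitive_collection \<BB> \<longleftrightarrow> (\<forall>\<bb>\<in>\<BB>. \<forall>\<bb>'\<in>\<BB>. \<bb> \<subseteq> \<bb>' \<longrightarrow> \<bb> = \<bb>')"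

definition pairwise_coprime :: "('a, 'm) ring_scheme \<Rightarrow> 'a set set \<Rightarrow> bool" where
  "pairwise_coprime R \<CC> \<longleftrightarrow> pairwise (\<lambda>\<cc> \<cc>'. \<cc> <+>\<^bsub>R\<^esub> \<cc>' = carrier R) \<CC>"

definition common_cofactors :: "('a, 'm) ring_scheme \<Rightarrow> 'a set set \<Rightarrow> 'a set set" where
  "common_cofactors R \<BB> =
     {\<dd>. ideal \<dd> R \<and> \<dd> \<noteq> {\<zero>\<^bsub>R\<^esub>} \<and>
        (\<exists>\<CC>. infinite \<CC> \<and> (\<forall>\<cc>\<in>\<CC>. ideal \<cc> R) \<and> pairwise_coprime R \<CC> \<and>
             {\<dd> \<cdot>\<^bsub>R\<^esub> \<cc> | \<cc>. \<cc> \<in> \<CC>} \<subseteq> \<BB>)}"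

end

theory Submission
  imports Defs
begin

text \<open>
  Let \<open>\<gg> = (r) + \<aa>\<close>, and suppose that no member of \<open>\<BB>\<close> contains \<open>\<gg>\<close>. If \<open>\<aa> = 0\<close> then \<open>r\<close> lies in
  some \<open>\<bb> \<in> \<BB>\<close>, and \<open>\<gg> = (r) \<subseteq> \<bb>\<close>. Over the rational integers the case \<open>\<aa> \<noteq> 0\<close> follows from
  Dirichlet's theorem: the coset contains \<open>g * p\<close>, where \<open>g\<close> generates \<open>\<gg>\<close>, for infinitely many
  primes \<open>p\<close>, and a member containing \<open>g * p\<close> but not \<open>g\<close> is generated by \<open>d * p\<close> with \<open>d dvd g\<close>.
  One \<open>d\<close> occurs infinitely often and is a common cofactor, a contradiction.

  Pairwise coprime cofactors do the work of the primes. The coset \<open>r + \<aa>\<close> contains a sequence \<open>X\<close>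
  with \<open>(X i) + (X j) = \<gg>\<close> for \<open>i \<noteq> j\<close> (\<open>ex_pairwise_coprime_sequence\<close>): given a nonzero \<open>y \<in> \<aa>\<close>
  divisible by the elements found so far, only finitely many maximal ideals contain \<open>y\<close>, and as in
  the Chinese remainder theorem the coset has an element outside \<open>\<gg> * P\<close> for each such \<open>P\<close>. Choose
  \<open>b n \<in> \<BB>\<close> containing \<open>X n\<close>. The ideals \<open>b n + \<gg>\<close> all contain \<open>\<gg>\<close>, so there are finitely many of
  them, and one ideal \<open>\<dd>\<close> equals \<open>b n + \<gg>\<close> for infinitely many \<open>n\<close>. For these \<open>n\<close>, to contain is
  to divide: \<open>b n = \<dd> * c n\<close> with \<open>c n = (b n : \<dd>)\<close>. If \<open>w * \<gg> \<subseteq> \<O>\<close>, with \<open>\<O>\<close> the ring of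
  integers, then \<open>w * X n\<close> multiplies both \<open>b n\<close> and \<open>\<gg>\<close> into \<open>b n\<close>, so it lies in \<open>c n\<close>. As
  \<open>(X i) + (X j) = \<gg>\<close> says that \<open>1 = v * X i + w * X j\<close> for some such \<open>v\<close> and \<open>w\<close>, the \<open>c n\<close> are
  pairwise coprime. They are proper since \<open>b n\<close> does not contain \<open>\<gg>\<close>; hence they are distinct, and
  \<open>\<dd>\<close> is a common cofactor (\<open>coset_covered_by_ideals\<close>).

  Two facts about number fields enter: nonzero ideals are invertible, and a nonzero element lies
  in only finitely many ideals. Both are derived from finiteness of the residue rings of nonzero
  elements together with a weak form of integral closedness. The residue rings are finite because
  the dimension of \<open>K\<close> over the rationals bounds how many elements of an additive subgroup can be
  independent modulo a prime \<open>p\<close> (\<open>finite_residues_prime\<close>).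
\<close>

section \<open>Integrally closed domains with finite residue rings\<close>

text \<open>
  The last two assumptions replace the usual description of a Dedekind domain. A root of
  \<open>X ^ k - X ^ j - a\<close> with \<open>a \<in> A\<close> is integral over \<open>A\<close>, and equations of this shape are what the
  pigeonhole principle in a finite residue ring produces. The condition \<open>(x - f) / m \<in> A\<close> is the
  congruence of \<open>x\<close> and \<open>f\<close> modulo \<open>m\<close>, written in the ambient field.
\<close>

locale integrally_closed_finite_quotients =
  fixes A :: "'k::field set"
  assumes one_closed: "1 \<in> A"
    and diff_closed: "x \<in> A \<Longrightarrow> y \<in> A \<Longrightarrow> x - y \<in> A"
    and mult_closed: "x \<in> A \<Longrightarrow> y \<in> A \<Longrightarrow> x * y \<in> A"
    and finite_residues:
      "m \<in> A \<Longrightarrow> m \<noteq> 0 \<Longrightarrow> \<exists>F. finite F \<and> (\<forall>x\<in>A. \<exists>f\<in>F. (x - f) / m \<in> A)"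
    and power_diff_integral: "j < k \<Longrightarrow> x ^ k - x ^ j \<in> A \<Longrightarrow> x \<in> A"
begin

abbreviation R :: "'k ring" where
  "R \<equiv> \<lparr>carrier = A, mult = (*), one = 1, zero = 0, add = (+)\<rparr>"

lemma zero_closed: "0 \<in> A"
  using diff_closed[OF one_closed one_closed] by simp

lemma uminus_closed: "x \<in> A \<Longrightarrow> - x \<in> A"
  using diff_closed[OF zero_closed] by fastforce

lemma add_closed: "x \<in> A \<Longrightarrow> y \<in> A \<Longrightarrow> x + y \<in> A"
  using diff_closed[OF _ uminus_closed, of x y] by simp

lemma power_closed: "x \<in> A \<Longrightarrow> x ^ n \<in> A"
  by (induction n) (auto intro: one_closed mult_closed)

lemma cring_R: "cring R"
proof (intro cringI abelian_groupI comm_monoidI)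
  fix x assume "x \<in> carrier R"
  then show "\<exists>y\<in>carrier R. y \<oplus>\<^bsub>R\<^esub> x = \<zero>\<^bsub>R\<^esub>"
    using uminus_closed by (intro bexI[of _ "- x"]) auto
qed (auto simp: algebra_simps intro: zero_closed one_closed add_closed mult_closed)

lemma ring_R: "ring R"
  using cring_R by (rule cring.axioms)

lemma ideal_iff:
  "ideal I R \<longleftrightarrow> I \<subseteq> A \<and> 0 \<in> I \<and> (\<forall>x\<in>I. \<forall>y\<in>I. x + y \<in> I) \<and> (\<forall>x\<in>I. \<forall>z\<in>A. z * x \<in> I)"
  (is "_ = ?rhs")
proof
  assume "ideal I R"
  then interpret I: ideal I R .
  show ?rhs
    using I.a_subset additive_subgroup.zero_closed[OF I.is_additive_subgroup]
      additive_subgroup.a_closed[OF I.is_additive_subgroup] I.I_l_closed by auto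
next
  assume I: ?rhs
  have inv: "inv\<^bsub>add_monoid R\<^esub> x = - x" if "x \<in> I" for x
  proof -
    interpret R: ring R by (rule ring_R)
    have "x \<in> A" using that I by blast
    then have "\<ominus>\<^bsub>R\<^esub> x = - x"
      using uminus_closed by (intro R.minus_equality) auto
    then show ?thesis by (simp add: a_inv_def)
  qed
  show "ideal I R"
  proof (rule idealI)
    have "- x \<in> I" if "x \<in> I" for x
      using I that uminus_closed[OF one_closed] by (metis mult_minus1)
    then show "subgroup I (add_monoid R)"
      using I by (intro subgroup.intro) (auto simp: inv[simplified])
  qed (use ring_R I in \<open>auto simp: mult.commute\<close>)
qed

lemma
  assumes "ideal I R"
  shows ideal_sub: "x \<in> I \<Longrightarrow> x \<in> A"
    and ideal_zero: "0 \<in> I"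
    and ideal_add: "x \<in> I \<Longrightarrow> y \<in> I \<Longrightarrow> x + y \<in> I"
    and ideal_mult: "x \<in> I \<Longrightarrow> z \<in> A \<Longrightarrow> z * x \<in> I"
    and ideal_mult': "x \<in> I \<Longrightarrow> z \<in> A \<Longrightarrow> x * z \<in> I"
  using assms unfolding ideal_iff by (auto simp: mult.commute)

lemma ideal_diff: "ideal I R \<Longrightarrow> x \<in> I \<Longrightarrow> y \<in> I \<Longrightarrow> x - y \<in> I"
  using ideal_add[of I x "- y"] ideal_mult[of I y "-1"] uminus_closed[OF one_closed] by simp

lemma ideal_add_cancel: "ideal I R \<Longrightarrow> x \<in> I \<Longrightarrow> x + y \<in> I \<longleftrightarrow> y \<in> I"
  using ideal_add[of I x y] ideal_diff[of I "x + y" x] by auto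

lemma pigeonhole_residues:
  assumes "m \<in> A" "m \<noteq> 0" "\<And>k. f k \<in> A"
  obtains j k :: nat where "j < k" "(f k - f j) / m \<in> A"
proof -
  obtain F where F: "finite F" "\<forall>x\<in>A. \<exists>f\<in>F. (x - f) / m \<in> A"
    using finite_residues assms by blast
  define g where "g k = (SOME h. h \<in> F \<and> (f k - h) / m \<in> A)" for k
  have "\<exists>h. h \<in> F \<and> (f k - h) / m \<in> A" for k
    using F(2) assms(3)[of k] by blast
  from someI_ex[OF this] have g: "g k \<in> F" "(f k - g k) / m \<in> A" for k
    unfolding g_def by blast+
  have "finite (range g)"
    by (rule finite_subset[OF _ F(1)]) (use g(1) in blast)
  then have "\<not> inj g"
    using finite_imageD[of g UNIV] by auto
  then obtain i k where ik: "i \<noteq> k" "g i = g k"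
    by (auto simp: inj_def)
  have *: "(f i - f j) / m \<in> A" if "g i = g j" for i j
  proof -
    have "(f i - f j) / m = (f i - g i) / m - (f j - g j) / m"
      using that by (simp add: diff_divide_distrib)
    with diff_closed[OF g(2)[of i] g(2)[of j]] show ?thesis by (simp only:)
  qed
  show thesis
    using ik(1)
  proof (cases i k rule: linorder_cases)
    case less
    then show ?thesis using that *[OF ik(2)[symmetric]] by blast
  next
    case greater
    then show ?thesis using that *[OF ik(2)] by blast
  qed simp
qed

text \<open>
  Two of the elements \<open>c * x ^ k\<close> agree modulo \<open>c\<close>, so two powers of \<open>x\<close> differ by an element of
  \<open>A\<close>. This takes the place of the determinant argument for finitely generated modules stable
  under \<open>x\<close>.
\<close>

lemma completely_integrally_closed:
  assumes "c \<in> A" "c \<noteq> 0" "\<And>k. c * x ^ k \<in> A"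
  shows "x \<in> A"
proof -
  obtain j k :: nat where jk: "j < k" "(c * x ^ k - c * x ^ j) / c \<in> A"
    using pigeonhole_residues[OF assms(1,2), of "\<lambda>k. c * x ^ k"] assms(3) by blast
  have "x ^ k - x ^ j \<in> A"
    using jk(2) assms(2) by (simp add: diff_divide_distrib)
  with jk(1) show ?thesis
    by (rule power_diff_integral)
qed

text \<open>
  Such an ideal is a union of residue classes modulo \<open>m\<close>.
\<close>

lemma finite_ideals_containing:
  assumes "m \<in> A" "m \<noteq> 0"
  shows "finite {I. ideal I R \<and> m \<in> I}"
proof -
  obtain F where F: "finite F" "\<forall>x\<in>A. \<exists>f\<in>F. (x - f) / m \<in> A"
    using finite_residues assms by blast
  have sub: "I \<subseteq> J"
    if I: "ideal I R" "m \<in> I" and J: "ideal J R" "m \<in> J" and eq: "I \<inter> F = J \<inter> F" for I J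
  proof
    fix x assume x: "x \<in> I"
    then obtain f where f: "f \<in> F" "(x - f) / m \<in> A"
      using F(2) ideal_sub[OF I(1)] by blast
    then have *: "x - f \<in> I" "x - f \<in> J"
      using ideal_mult[OF I f(2)] ideal_mult[OF J f(2)] assms(2) by simp_all
    then have "f \<in> I"
      using ideal_diff[OF I(1) x *(1)] by simp
    then have "f \<in> J"
      using f(1) eq by blast
    then show "x \<in> J"
      using ideal_add[OF J(1) *(2), of f] by simp
  qed
  have "inj_on (\<lambda>I. I \<inter> F) {I. ideal I R \<and> m \<in> I}"
  proof (rule inj_onI)
    fix I J assume "I \<in> {I. ideal I R \<and> m \<in> I}" "J \<in> {I. ideal I R \<and> m \<in> I}" "I \<inter> F = J \<inter> F"
    then show "I = J"
      using sub[of I J] sub[of J I] by blast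
  qed
  moreover have "(\<lambda>I. I \<inter> F) ` {I. ideal I R \<and> m \<in> I} \<subseteq> Pow F"
    by auto
  then have "finite ((\<lambda>I. I \<inter> F) ` {I. ideal I R \<and> m \<in> I})"
    by (rule finite_subset) (use F(1) in simp)
  ultimately show ?thesis
    by (rule finite_imageD[rotated])
qed

lemma one_in_ideal: "ideal I R \<Longrightarrow> 1 \<in> I \<Longrightarrow> I = A"
  using ideal_mult'[of I 1] ideal_sub by auto

lemma ex_maximalideal:
  assumes J: "ideal J R" "y \<in> J" "y \<noteq> 0" "1 \<notin> J"
  obtains P where "maximalideal P R" "J \<subseteq> P"
proof -
  define M where "M = {I. ideal I R \<and> J \<subseteq> I \<and> 1 \<notin> I}"
  have "finite M"
    by (rule finite_subset[OF _ finite_ideals_containing[OF ideal_sub[OF J(1,2)] J(3)]])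
      (use J(2) in \<open>auto simp: M_def\<close>)
  moreover have "J \<in> M" using J by (simp add: M_def)
  ultimately obtain P where P: "P \<in> M" "\<And>Q. Q \<in> M \<Longrightarrow> P \<subseteq> Q \<Longrightarrow> P = Q"
    using finite_has_maximal[of M] by blast
  have "maximalideal P R"
  proof (rule maximalidealI)
    fix Q assume "ideal Q R" "P \<subseteq> Q" "Q \<subseteq> carrier R"
    then show "Q = P \<or> Q = carrier R"
      using P(1) P(2)[of Q] one_in_ideal[of Q]
      by (cases "1 \<in> Q") (simp, simp add: M_def, blast)
  qed (use P one_closed in \<open>auto simp: M_def\<close>)
  then show thesis
    using that P(1) by (auto simp: M_def)
qed

lemma maximalideal_primeideal: "maximalideal P R \<Longrightarrow> primeideal P R"
  by (rule cring.maximalideal_prime[OF cring_R])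

lemma
  assumes "primeideal P R"
  shows prime_ideal: "ideal P R"
    and prime_one: "1 \<notin> P"
    and prime_mult: "x \<in> A \<Longrightarrow> y \<in> A \<Longrightarrow> x * y \<in> P \<Longrightarrow> x \<in> P \<or> y \<in> P"
proof -
  interpret P: primeideal P R by fact
  show I: "ideal P R" by (rule P.is_ideal)
  show "1 \<notin> P" using P.I_notcarr one_in_ideal[OF I] by auto
  show "x \<in> A \<Longrightarrow> y \<in> A \<Longrightarrow> x * y \<in> P \<Longrightarrow> x \<in> P \<or> y \<in> P"
    using P.I_prime[of x y] by simp
qed

lemma prime_power: "primeideal P R \<Longrightarrow> p \<in> P \<Longrightarrow> 0 < n \<Longrightarrow> p ^ n \<in> P"
  by (cases n) (auto intro!: ideal_mult' prime_ideal power_closed ideal_sub[OF prime_ideal])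

section \<open>Invertibility of ideals\<close>

text \<open>
  This is the classical fact that the inverse of a nonzero prime ideal \<open>P\<close> is strictly larger than
  the ring. The search starts from \<open>1 / m\<close> and keeps the invariant that the denominator ideal
  \<open>{s \<in> A. s * x \<in> A}\<close> of \<open>x\<close> is contained in \<open>P\<close>, which in particular prevents \<open>x\<close> from being in
  \<open>A\<close>. For \<open>p \<in> P\<close> the powers of \<open>p\<close> repeat modulo \<open>m\<close>, so \<open>p ^ j * (p ^ (k - j) - 1)\<close> is
  divisible by \<open>m\<close>, and the second factor is not in \<open>P\<close>. Hence multiplying \<open>x\<close> by \<open>p\<close> repeatedly
  must destroy the invariant; stopping just before, and multiplying by a suitable element outside
  \<open>P\<close>, gives an \<open>x\<close> that still satisfies it and for which \<open>x * p \<in> A\<close>. Finitely many \<open>p\<close> represent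
  \<open>P\<close> modulo \<open>m\<close>.
\<close>

lemma ex_fractional_multiplier:
  assumes P: "primeideal P R" and m: "m \<in> P" "m \<noteq> 0"
  obtains x where "x \<notin> A" "\<And>p. p \<in> P \<Longrightarrow> x * p \<in> A"
proof -
  note PI = prime_ideal[OF P]
  have mA: "m \<in> A" using ideal_sub[OF PI m(1)] .
  define local where "local x \<longleftrightarrow> (\<forall>s\<in>A. s * x \<in> A \<longrightarrow> s \<in> P)" for x
  have step: "\<exists>z\<in>A. local (z * x) \<and> z * x * p \<in> A"
    if x: "m * x \<in> A" "local x" and p: "p \<in> P" for x p
  proof -
    have pA: "p \<in> A" using ideal_sub[OF PI p] .
    obtain j k :: nat where jk: "j < k" "(p ^ k - p ^ j) / m \<in> A"
      using pigeonhole_residues[OF mA m(2), of "\<lambda>k. p ^ k"] power_closed[OF pA] by blast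
    have "p ^ k = p ^ j * p ^ (k - j)" using jk(1) by (simp flip: power_add)
    then have "(p ^ (k - j) - 1) * (p ^ j * x) = ((p ^ k - p ^ j) / m) * (m * x)"
      using m(2) by (simp add: left_diff_distrib diff_divide_distrib)
    also have "\<dots> \<in> A" by (intro mult_closed jk x)
    finally have 1: "(p ^ (k - j) - 1) * (p ^ j * x) \<in> A" .
    have "p ^ (k - j) \<in> P" using prime_power[OF P p] jk(1) by simp
    then have 2: "p ^ (k - j) - 1 \<notin> P"
      using ideal_diff[OF PI, of "p ^ (k - j)" "p ^ (k - j) - 1"] prime_one[OF P] by auto
    have 3: "p ^ (k - j) - 1 \<in> A" by (intro diff_closed power_closed pA one_closed)
    have ex: "\<not> local (p ^ j * x)"
      using 1 2 3 by (auto simp: local_def)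
    \<comment> \<open>the last power of \<open>p\<close> by which \<open>x\<close> can be multiplied is \<open>l\<close>\<close>
    define i where "i = (LEAST i. \<not> local (p ^ i * x))"
    have i: "\<not> local (p ^ i * x)" unfolding i_def by (rule LeastI) (rule ex)
    have "i \<noteq> 0" using i x(2) by (intro notI) simp
    then obtain l where l: "i = Suc l" using not0_implies_Suc by blast
    have "l < i" using l by simp
    then have loc: "local (p ^ l * x)" using not_less_Least unfolding i_def by blast
    obtain s where s: "s \<in> A" "s * (p ^ Suc l * x) \<in> A" "s \<notin> P"
      using i unfolding local_def l by blast
    have "local (s * p ^ l * x)"
      unfolding local_def
    proof (intro ballI impI)
      fix t assume t: "t \<in> A" "t * (s * p ^ l * x) \<in> A"
      then have "t * s \<in> P"
        using loc s(1) mult_closed[OF t(1) s(1)] by (auto simp: local_def mult.assoc)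
      then show "t \<in> P" using prime_mult[OF P t(1) s(1)] s(3) by blast
    qed
    moreover have "s * p ^ l * x * p \<in> A" using s(2) by (simp add: mult_ac)
    moreover have "s * p ^ l \<in> A" by (intro mult_closed power_closed s pA)
    ultimately show ?thesis by blast
  qed
  obtain F where F: "finite F" "\<forall>x\<in>A. \<exists>f\<in>F. (x - f) / m \<in> A"
    using finite_residues mA m(2) by blast
  have "\<exists>x. m * x \<in> A \<and> local x \<and> (\<forall>f\<in>G. x * f \<in> A)" if "finite G" "G \<subseteq> P" for G
    using that
  proof (induction G rule: finite_induct)
    case empty
    have "local (1 / m)"
      unfolding local_def
    proof (intro ballI impI)
      fix s assume "s * (1 / m) \<in> A"
      from ideal_mult[OF PI m(1) this] show "s \<in> P" using m(2) by simp
    qed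
    then show ?case using one_closed m(2) by (intro exI[of _ "1 / m"]) auto
  next
    case (insert p G)
    then obtain x where x: "m * x \<in> A" "local x" "\<forall>f\<in>G. x * f \<in> A" by auto
    obtain z where z: "z \<in> A" "local (z * x)" "z * x * p \<in> A"
      using step[OF x(1,2), of p] insert.prems by auto
    have "m * (z * x) \<in> A"
      using mult_closed[OF z(1) x(1)] by (simp add: mult_ac)
    moreover have "z * x * f \<in> A" if "f \<in> G" for f
      using mult_closed[OF z(1), of "x * f"] x(3) that by (simp add: mult.assoc)
    ultimately show ?case using z by auto
  qed
  from this[of "F \<inter> P"] obtain x
    where x: "m * x \<in> A" "local x" "\<forall>f\<in>F \<inter> P. x * f \<in> A" using F(1) by auto
  show thesis
  proof
    show "x \<notin> A"
      using x(2) one_closed prime_one[OF P] by (auto simp: local_def)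
    fix p assume p: "p \<in> P"
    then obtain f where f: "f \<in> F" "(p - f) / m \<in> A"
      using F(2) ideal_sub[OF PI] by blast
    have "p - f \<in> P" using ideal_mult[OF PI m(1) f(2)] m(2) by simp
    then have "f \<in> P" using ideal_diff[OF PI p, of "p - f"] by simp
    moreover have "x * p = x * f + (m * x) * ((p - f) / m)"
      using m(2) by (simp add: field_simps)
    ultimately show "x * p \<in> A"
      using add_closed[OF _ mult_closed[OF x(1) f(2)], of "x * f"] x(3) f(1) by simp
  qed
qed

definition inverse_ideal :: "'k set \<Rightarrow> 'k set" where
  "inverse_ideal I = {w. \<forall>i\<in>I. w * i \<in> A}"

lemma inverse_idealD: "w \<in> inverse_ideal I \<Longrightarrow> i \<in> I \<Longrightarrow> w * i \<in> A"
  by (simp add: inverse_ideal_def)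

lemma one_in_inverse_ideal: "ideal I R \<Longrightarrow> 1 \<in> inverse_ideal I"
  by (auto simp: inverse_ideal_def intro: ideal_sub)

text \<open>
  If \<open>inverse_ideal I * I\<close> were contained in \<open>P\<close>, then each \<open>x\<close> with \<open>x * P \<subseteq> A\<close> would map
  \<open>inverse_ideal I\<close> into itself. That set would contain all powers of \<open>x\<close>, and \<open>x\<close> would lie in
  \<open>A\<close> by integral closedness, whereas some such \<open>x\<close> does not.
\<close>

lemma inverse_ideal_product_not_in_prime:
  assumes I: "ideal I R" "c \<in> I" "c \<noteq> 0" and P: "primeideal P R"
  shows "\<exists>w\<in>inverse_ideal I. \<exists>i\<in>I. w * i \<notin> P"
proof (rule ccontr)
  assume "\<not> ?thesis"
  then have all: "w * i \<in> P" if "w \<in> inverse_ideal I" "i \<in> I" for w i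
    using that by blast
  have "c \<in> P" using all[OF one_in_inverse_ideal[OF I(1)] I(2)] by simp
  then obtain x where x: "x \<notin> A" "\<And>p. p \<in> P \<Longrightarrow> x * p \<in> A"
    using ex_fractional_multiplier[OF P _ I(3)] by blast
  have pow: "x ^ k \<in> inverse_ideal I" for k
  proof (induction k)
    case (Suc k)
    then show ?case using x(2)[OF all[OF Suc]] by (simp add: inverse_ideal_def mult.assoc)
  qed (use one_in_inverse_ideal[OF I(1)] in simp)
  have "c * x ^ k \<in> A" for k
    using inverse_idealD[OF pow I(2)] by (simp add: mult.commute)
  then show False
    using completely_integrally_closed[of c x] ideal_sub[OF I(1,2)] I(3) x(1) by blast
qed

text \<open>
  The product is an ideal of \<open>A\<close> and, by the previous lemma, contained in no maximal ideal, so it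
  is all of \<open>A\<close>: nonzero ideals are invertible. The operation \<open>ideal_prod\<close> only uses the addition
  and multiplication of the ring, so it also describes the product with a fractional ideal.
\<close>

lemma one_in_product_inverse_ideal:
  assumes I: "ideal I R" "c \<in> I" "c \<noteq> 0"
  shows "1 \<in> inverse_ideal I \<cdot>\<^bsub>R\<^esub> I"
proof (rule ccontr)
  let ?J = "inverse_ideal I \<cdot>\<^bsub>R\<^esub> I"
  assume 1: "1 \<notin> ?J"
  have in_J: "w * i \<in> ?J" if "w \<in> inverse_ideal I" "i \<in> I" for w i
    using ideal_prod.prod[OF that, of R] by simp
  have add_J: "x + y \<in> ?J" if "x \<in> ?J" "y \<in> ?J" for x y
    using ideal_prod.sum[OF that] by simp
  have sub: "x \<in> A" if "x \<in> ?J" for x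
    using that
  proof induction
    case (prod w i)
    then show ?case using inverse_idealD by simp
  next
    case (sum x y)
    then show ?case using add_closed by simp
  qed
  have mult: "z * x \<in> ?J" if "x \<in> ?J" "z \<in> A" for x z
    using that
  proof induction
    case (prod w i)
    have "w * (z * i) \<in> ?J"
      using in_J[OF prod(1)] ideal_mult[OF I(1)] prod by blast
    then show ?case by (simp add: mult_ac)
  next
    case (sum x y)
    then show ?case using add_J[of "z * x" "z * y"] by (simp add: distrib_left)
  qed
  have c: "c \<in> ?J" using in_J[OF one_in_inverse_ideal[OF I(1)] I(2)] by simp
  have "0 \<in> ?J" using mult[OF c zero_closed] by simp
  then have "ideal ?J R" unfolding ideal_iff using sub add_J mult by (intro conjI subsetI ballI)
  then obtain P where P: "maximalideal P R" "?J \<subseteq> P"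
    using ex_maximalideal[OF _ c I(3) 1] by blast
  then show False
    using inverse_ideal_product_not_in_prime[OF I maximalideal_primeideal[OF P(1)]] in_J P(2) by blast
qed

definition ideal_quotient :: "'k set \<Rightarrow> 'k set \<Rightarrow> 'k set" where
  "ideal_quotient J I = {z \<in> A. \<forall>i\<in>I. z * i \<in> J}"

lemma ideal_ideal_quotient:
  assumes "ideal J R"
  shows "ideal (ideal_quotient J I) R"
  unfolding ideal_iff ideal_quotient_def
  by (auto simp: distrib_right mult.assoc intro: zero_closed add_closed mult_closed
      ideal_zero[OF assms] ideal_add[OF assms] ideal_mult[OF assms])

text \<open>
  Multiplying \<open>J\<close> by an expression of \<open>1\<close> in \<open>inverse_ideal I * I\<close> writes each element of \<open>J\<close> as a
  sum of products of elements \<open>i \<in> I\<close> with elements \<open>w * x\<close>, where \<open>w\<close> is in the inverse of \<open>I\<close>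
  and \<open>x \<in> J\<close>; such \<open>w * x\<close> lie in the quotient.
\<close>

lemma to_contain_is_to_divide:
  assumes I: "ideal I R" "c \<in> I" "c \<noteq> 0" and J: "ideal J R" "J \<subseteq> I"
  shows "I \<cdot>\<^bsub>R\<^esub> ideal_quotient J I = J"
proof
  have "x \<in> J" if "x \<in> I \<cdot>\<^bsub>R\<^esub> ideal_quotient J I" for x
    using that
    by induction (auto simp: ideal_quotient_def mult.commute intro: ideal_add[OF J(1)])
  then show "I \<cdot>\<^bsub>R\<^esub> ideal_quotient J I \<subseteq> J" by blast
next
  have *: "t * x \<in> I \<cdot>\<^bsub>R\<^esub> ideal_quotient J I"
    if "t \<in> inverse_ideal I \<cdot>\<^bsub>R\<^esub> I" "x \<in> J" for t x
    using that
  proof induction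
    case (prod w i)
    have "w * x \<in> A" using inverse_idealD[OF prod(1)] J(2) prod(3) by blast
    moreover have "w * x * i' \<in> J" if "i' \<in> I" for i'
      using ideal_mult[OF J(1) prod(3) inverse_idealD[OF prod(1) that]] by (simp add: mult_ac)
    ultimately have "w * x \<in> ideal_quotient J I" by (simp add: ideal_quotient_def)
    from ideal_prod.prod[OF prod(2) this, of R] show ?case by (simp add: mult_ac)
  next
    case (sum s t)
    then show ?case
      using ideal_prod.sum[of "s * x" R I _ "t * x"] by (simp add: distrib_right)
  qed
  show "J \<subseteq> I \<cdot>\<^bsub>R\<^esub> ideal_quotient J I"
    using *[OF one_in_product_inverse_ideal[OF I]] by auto
qed

section \<open>Elements of a coset with prescribed greatest common divisor\<close>

definition gcd_ideal :: "'k \<Rightarrow> 'k set \<Rightarrow> 'k set" where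
  "gcd_ideal r \<aa> = {u * r + s | u s. u \<in> A \<and> s \<in> \<aa>}"

lemma sub_gcd_ideal: "\<aa> \<subseteq> gcd_ideal r \<aa>"
  using zero_closed unfolding gcd_ideal_def by force

lemma coset_sub_gcd_ideal: "s \<in> \<aa> \<Longrightarrow> r + s \<in> gcd_ideal r \<aa>"
  using one_closed unfolding gcd_ideal_def by force

lemma ideal_gcd_ideal:
  assumes a: "ideal \<aa> R" and r: "r \<in> A"
  shows "ideal (gcd_ideal r \<aa>) R"
  unfolding ideal_iff
proof (intro conjI ballI subsetI)
  show "0 \<in> gcd_ideal r \<aa>"
    using sub_gcd_ideal ideal_zero[OF a] by blast
next
  fix x assume "x \<in> gcd_ideal r \<aa>"
  then show "x \<in> A"
    using r ideal_sub[OF a] by (auto simp: gcd_ideal_def intro!: add_closed mult_closed)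
next
  fix x y assume "x \<in> gcd_ideal r \<aa>" "y \<in> gcd_ideal r \<aa>"
  then obtain u s u' s' where "x = u * r + s" "y = u' * r + s'"
    "u \<in> A" "s \<in> \<aa>" "u' \<in> A" "s' \<in> \<aa>" by (auto simp: gcd_ideal_def)
  then have "x + y = (u + u') * r + (s + s')" "u + u' \<in> A" "s + s' \<in> \<aa>"
    using add_closed ideal_add[OF a] by (simp_all add: algebra_simps)
  then show "x + y \<in> gcd_ideal r \<aa>" unfolding gcd_ideal_def by blast
next
  fix x z assume "x \<in> gcd_ideal r \<aa>" and z: "z \<in> A"
  then obtain u s where "x = u * r + s" "u \<in> A" "s \<in> \<aa>" by (auto simp: gcd_ideal_def)
  then have "z * x = (z * u) * r + z * s" "z * u \<in> A" "z * s \<in> \<aa>"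
    using z mult_closed ideal_mult[OF a] by (simp_all add: algebra_simps)
  then show "z * x \<in> gcd_ideal r \<aa>" unfolding gcd_ideal_def by blast
qed

text \<open>
  With \<open>\<gg> = gcd_ideal r \<aa>\<close>, the condition on \<open>r + s\<close> says that it is not in the ideal \<open>\<gg> * P\<close>. For
  one \<open>P\<close> it can be achieved because \<open>r\<close> and \<open>\<aa>\<close> generate \<open>\<gg>\<close>, which is not contained in \<open>\<gg> * P\<close>.
  Another ideal \<open>P\<close> is added by a correction \<open>e * t\<close> with \<open>t \<in> \<aa>\<close> outside \<open>\<gg> * P\<close>, where \<open>e\<close> is
  outside \<open>P\<close> but in all the ideals that were treated before and are left undisturbed.
\<close>

lemma avoid_maximal_ideals:
  assumes a: "ideal \<aa> R" and r: "r \<in> A"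
    and c: "c \<in> gcd_ideal r \<aa>" "c \<noteq> 0"
    and F: "finite F" "\<And>P. P \<in> F \<Longrightarrow> maximalideal P R"
  shows "\<exists>s\<in>\<aa>. \<forall>P\<in>F. \<exists>w\<in>inverse_ideal (gcd_ideal r \<aa>). w * (r + s) \<notin> P"
  using F
proof (induction F rule: finite_induct)
  case empty
  then show ?case using ideal_zero[OF a] by blast
next
  case (insert P F)
  then obtain s where s: "s \<in> \<aa>" "\<forall>Q\<in>F. \<exists>w\<in>inverse_ideal (gcd_ideal r \<aa>). w * (r + s) \<notin> Q" by auto
  have P: "primeideal P R" using insert.prems maximalideal_primeideal by blast
  note PI = prime_ideal[OF P]
  note PF = insert.hyps(2) and maxF = insert.prems
  note g = ideal_gcd_ideal[OF a r]
  have ag: "t \<in> gcd_ideal r \<aa>" if "t \<in> \<aa>" for t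
    using sub_gcd_ideal that by blast
  show ?case
  proof (cases "\<exists>w\<in>inverse_ideal (gcd_ideal r \<aa>). w * (r + s) \<notin> P")
    case True
    then show ?thesis using s by auto
  next
    case False
    then have rs: "w * (r + s) \<in> P" if "w \<in> inverse_ideal (gcd_ideal r \<aa>)" for w using that by blast
    obtain w i where wi: "w \<in> inverse_ideal (gcd_ideal r \<aa>)" "i \<in> gcd_ideal r \<aa>" "w * i \<notin> P"
      using inverse_ideal_product_not_in_prime[OF g c P] by blast
    have "\<exists>t\<in>\<aa>. w * t \<notin> P"
    proof (rule ccontr)
      assume "\<not> ?thesis"
      then have all: "w * t \<in> P" if "t \<in> \<aa>" for t using that by blast
      have "w * r \<in> P" using rs[OF wi(1)] all[OF s(1)] ideal_diff[OF PI, of "w * (r + s)" "w * s"]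
        by (simp add: algebra_simps)
      moreover obtain u s' where us: "u \<in> A" "s' \<in> \<aa>" "i = u * r + s'" using wi(2) unfolding gcd_ideal_def by blast
      moreover have "w * i = u * (w * r) + w * s'" using us(3) by (simp add: algebra_simps)
      ultimately have "w * i \<in> P"
        using ideal_add[OF PI ideal_mult[OF PI, of "w * r" u] all[of s']] by simp
      then show False using wi(3) by blast
    qed
    then obtain t where t: "t \<in> \<aa>" "w * t \<notin> P" by blast
    have "\<exists>e\<in>A. e \<notin> P \<and> (\<forall>Q\<in>G. e \<in> Q)" if "finite G" "G \<subseteq> F" for G
      using that
    proof (induction G rule: finite_induct)
      case empty
      then show ?case using one_closed prime_one[OF P] by blast
    next
      case (insert Q G)
      then obtain e where e: "e \<in> A" "e \<notin> P" "\<forall>Q\<in>G. e \<in> Q" by auto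
      have QF: "Q \<in> F" using insert.prems by blast
      have Q: "maximalideal Q R" "Q \<noteq> P"
        using QF PF maxF by auto
      interpret Q: maximalideal Q R by fact
      have "\<not> Q \<subseteq> P"
        using Q.I_maximal[OF PI] ideal_sub[OF PI] Q(2) primeideal.I_notcarr[OF P] by auto
      then obtain q where q: "q \<in> Q" "q \<notin> P" by blast
      have qA: "q \<in> A" using ideal_sub[OF Q.is_ideal q(1)] .
      have "q * e \<notin> P" using prime_mult[OF P qA e(1)] q e by blast
      moreover have "q * e \<in> Q" using ideal_mult'[OF Q.is_ideal q(1) e(1)] .
      moreover have "q * e \<in> Q'" if "Q' \<in> G" for Q'
      proof -
        have "Q' \<in> insert P F" using that insert.prems by blast
        then have "ideal Q' R"
          using maxF maximalideal.axioms(1) by blast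
        then show ?thesis using ideal_mult[of Q' e q] e(3) that qA by blast
      qed
      ultimately show ?case using mult_closed[OF qA e(1)] by auto
    qed
    from this[OF insert.hyps(1) order_refl] obtain e
      where e: "e \<in> A" "e \<notin> P" "\<forall>Q\<in>F. e \<in> Q" by blast
    have wt: "v * t \<in> A" if "v \<in> inverse_ideal (gcd_ideal r \<aa>)" for v
      using inverse_idealD[OF that ag[OF t(1)]] .
    have split: "v * (r + (s + e * t)) = e * (v * t) + v * (r + s)" for v
      by (simp add: algebra_simps)
    have "w * (r + (s + e * t)) \<notin> P"
    proof
      assume "w * (r + (s + e * t)) \<in> P"
      then have "e * (w * t) \<in> P"
        using ideal_diff[OF PI _ rs[OF wi(1)]] unfolding split by fastforce
      then show False using prime_mult[OF P e(1) wt[OF wi(1)]] e(2) t(2) by blast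
    qed
    moreover have "\<exists>v\<in>inverse_ideal (gcd_ideal r \<aa>). v * (r + (s + e * t)) \<notin> Q" if Q: "Q \<in> F" for Q
    proof -
      obtain v where v: "v \<in> inverse_ideal (gcd_ideal r \<aa>)" "v * (r + s) \<notin> Q"
        using s(2) Q by blast
      have QI: "ideal Q R"
        using maxF Q by (auto intro: maximalideal.axioms(1))
      have "e \<in> Q" using e(3) Q by blast
      then have "e * (v * t) \<in> Q" using ideal_mult'[OF QI] wt[OF v(1)] by blast
      then have "v * (r + (s + e * t)) \<notin> Q"
        using ideal_add_cancel[OF QI, of "e * (v * t)" "v * (r + s)"] v(2) unfolding split by blast
      then show ?thesis using v(1) by blast
    qed
    moreover have "s + e * t \<in> \<aa>" by (intro ideal_add[OF a] ideal_mult[OF a] s t e)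
    ultimately show ?thesis using wi(1) by auto
  qed
qed

lemma inverse_ideal_add:
  "v \<in> inverse_ideal I \<Longrightarrow> w \<in> inverse_ideal I \<Longrightarrow> v + w \<in> inverse_ideal I"
  using add_closed by (simp add: inverse_ideal_def distrib_right)

lemma inverse_ideal_mult: "z \<in> A \<Longrightarrow> w \<in> inverse_ideal I \<Longrightarrow> z * w \<in> inverse_ideal I"
  using mult_closed by (simp add: inverse_ideal_def mult.assoc)

text \<open>
  For \<open>x\<close> and \<open>y\<close> in a nonzero ideal \<open>I\<close> this says that \<open>(x) + (y) = I\<close>, multiplied by the inverse
  of \<open>I\<close>.
\<close>

definition coprime_over :: "'k set \<Rightarrow> 'k \<Rightarrow> 'k \<Rightarrow> bool" where
  "coprime_over I x y \<longleftrightarrow> (\<exists>v\<in>inverse_ideal I. \<exists>w\<in>inverse_ideal I. v * x + w * y = 1)"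

lemma coprime_over_sym: "coprime_over I x y \<Longrightarrow> coprime_over I y x"
  unfolding coprime_over_def by (metis add.commute)

text \<open>
  For \<open>\<gg> = gcd_ideal r \<aa>\<close>, the ideal of all \<open>v * (r + s) + w * y\<close> with \<open>v\<close> and \<open>w\<close> in the inverse
  of \<open>\<gg>\<close> contains \<open>y\<close>. If it is proper, it is contained in one of the finitely many maximal ideals
  containing \<open>y\<close>, and \<open>s\<close> is chosen so as to exclude these.
\<close>

lemma ex_coprime_in_coset:
  assumes a: "ideal \<aa> R" and r: "r \<in> A" and y: "y \<in> \<aa>" "y \<noteq> 0"
  shows "\<exists>s\<in>\<aa>. r + s \<noteq> 0 \<and> coprime_over (gcd_ideal r \<aa>) (r + s) y"
proof -
  let ?g = "gcd_ideal r \<aa>"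
  note g = ideal_gcd_ideal[OF a r]
  have yg: "y \<in> ?g" using sub_gcd_ideal y(1) by blast
  have yA: "y \<in> A" using ideal_sub[OF a y(1)] .
  define F where "F = {P. maximalideal P R \<and> y \<in> P}"
  have "finite F"
    by (rule finite_subset[OF _ finite_ideals_containing[OF yA y(2)]])
      (auto simp: F_def intro: maximalideal.axioms(1))
  from avoid_maximal_ideals[OF a r yg y(2) this]
  obtain s where s: "s \<in> \<aa>" "\<And>P. P \<in> F \<Longrightarrow> \<exists>w\<in>inverse_ideal ?g. w * (r + s) \<notin> P"
    by (auto simp: F_def)
  have zero: "0 \<in> inverse_ideal ?g" using zero_closed by (simp add: inverse_ideal_def)
  note one = one_in_inverse_ideal[OF g]
  define J where "J = {v * (r + s) + w * y | v w. v \<in> inverse_ideal ?g \<and> w \<in> inverse_ideal ?g}"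
  have J: "v * (r + s) + w * y \<in> J" if "v \<in> inverse_ideal ?g" "w \<in> inverse_ideal ?g" for v w
    using that unfolding J_def by blast
  have "ideal J R"
    unfolding ideal_iff
  proof (intro conjI ballI subsetI)
    show "0 \<in> J" using J[OF zero zero] by simp
  next
    fix x assume "x \<in> J"
    then show "x \<in> A"
      using inverse_idealD coset_sub_gcd_ideal[OF s(1)] yg add_closed unfolding J_def by blast
  next
    fix x x' assume "x \<in> J" "x' \<in> J"
    then obtain v w v' w' where
      "x = v * (r + s) + w * y" "v \<in> inverse_ideal ?g" "w \<in> inverse_ideal ?g"
      "x' = v' * (r + s) + w' * y" "v' \<in> inverse_ideal ?g" "w' \<in> inverse_ideal ?g"
      unfolding J_def by blast
    then show "x + x' \<in> J"
      using J[OF inverse_ideal_add inverse_ideal_add, of v v' w w'] by (simp add: algebra_simps)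
  next
    fix x z assume "x \<in> J" "z \<in> A"
    then obtain v w where
      "x = v * (r + s) + w * y" "v \<in> inverse_ideal ?g" "w \<in> inverse_ideal ?g"
      unfolding J_def by blast
    then show "z * x \<in> J"
      using J[OF inverse_ideal_mult inverse_ideal_mult, of z v z w] \<open>z \<in> A\<close>
      by (simp add: algebra_simps)
  qed
  moreover have "y \<in> J" using J[OF zero one] by simp
  moreover have "\<not> (maximalideal P R \<and> J \<subseteq> P)" for P
  proof
    assume P: "maximalideal P R \<and> J \<subseteq> P"
    then have "P \<in> F" using \<open>y \<in> J\<close> by (auto simp: F_def)
    then obtain w where "w \<in> inverse_ideal ?g" "w * (r + s) \<notin> P" using s(2) by blast
    then show False using J[OF _ zero, of w] P by auto
  qed
  ultimately have "1 \<in> J" using ex_maximalideal[OF _ _ y(2)] by blast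
  then have cop: "coprime_over ?g (r + s) y"
    unfolding J_def coprime_over_def by force
  show ?thesis
  proof (cases "r + s = 0")
    case False
    then show ?thesis using s(1) cop by blast
  next
    case True
    then obtain w where w: "w \<in> inverse_ideal ?g" "w * y = 1"
      using cop unfolding coprime_over_def by auto
    \<comment> \<open>here \<open>y\<close> itself generates \<open>\<gg>\<close> and lies in the coset, since \<open>r + s = 0\<close>\<close>
    have "r + (s + y) = y" using True by (simp flip: add.assoc)
    moreover have "coprime_over ?g y y"
      unfolding coprime_over_def using w zero by (intro bexI[of _ w] bexI[of _ 0]) auto
    ultimately show ?thesis
      using ideal_add[OF a s(1) y(1)] y(2) by metis
  qed
qed

text \<open>
  The next element is chosen coprime over \<open>gcd_ideal r \<aa>\<close> to the product of \<open>y\<close> and all earlier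
  elements. The factor \<open>y\<close> keeps the product in \<open>\<aa>\<close>, and as the elements are nonzero it never
  vanishes.
\<close>

lemma ex_pairwise_coprime_sequence:
  assumes a: "ideal \<aa> R" and r: "r \<in> A" and y: "y \<in> \<aa>" "y \<noteq> 0"
  obtains X :: "nat \<Rightarrow> 'k"
  where "\<And>n. \<exists>s\<in>\<aa>. X n = r + s"
    and "\<And>i j. i \<noteq> j \<Longrightarrow> coprime_over (gcd_ideal r \<aa>) (X i) (X j)"
proof -
  let ?g = "gcd_ideal r \<aa>"
  from ex_coprime_in_coset[OF a r]
  have "\<forall>y\<in>\<aa> - {0}. \<exists>s. s \<in> \<aa> \<and> r + s \<noteq> 0 \<and> coprime_over ?g (r + s) y"
    by blast
  from bchoice[OF this] obtain h
    where h: "\<And>y. y \<in> \<aa> \<Longrightarrow> y \<noteq> 0 \<Longrightarrow> h y \<in> \<aa>"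
      "\<And>y. y \<in> \<aa> \<Longrightarrow> y \<noteq> 0 \<Longrightarrow> r + h y \<noteq> 0"
      "\<And>y. y \<in> \<aa> \<Longrightarrow> y \<noteq> 0 \<Longrightarrow> coprime_over ?g (r + h y) y"
    by blast
  define Y where "Y = rec_nat y (\<lambda>_ z. (r + h z) * z)"
  have Y_0: "Y 0 = y" and Y_Suc: "Y (Suc n) = (r + h (Y n)) * Y n" for n
    by (simp_all add: Y_def)
  have hA: "r + h z \<in> A" if "z \<in> \<aa>" "z \<noteq> 0" for z
    using add_closed[OF r ideal_sub[OF a h(1)[OF that]]] .
  have Y: "Y n \<in> \<aa> \<and> Y n \<noteq> 0" for n
  proof (induction n)
    case (Suc n)
    then show ?case using h(2) hA ideal_mult[OF a] by (simp add: Y_Suc)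
  qed (simp add: Y_0 y)
  define X where "X n = r + h (Y n)" for n
  have dvd: "\<exists>z\<in>A. Y j = z * X i" if "i < j" for i j
    using that
  proof (induction j)
    case (Suc j)
    show ?case
    proof (cases "i = j")
      case True
      then show ?thesis
        using Y[of j] ideal_sub[OF a] by (intro bexI[of _ "Y j"]) (auto simp: Y_Suc X_def)
    next
      case False
      then obtain z where z: "z \<in> A" "Y j = z * X i" using Suc by auto
      have "X j * z \<in> A" using mult_closed[OF hA z(1)] Y by (simp add: X_def)
      then show ?thesis using z by (intro bexI[of _ "X j * z"]) (simp_all add: Y_Suc X_def)
    qed
  qed simp
  have cop: "coprime_over ?g (X i) (X j)" if ij: "i < j" for i j
  proof -
    obtain z where z: "z \<in> A" "Y j = z * X i" using dvd[OF ij] by blast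
    obtain v w where vw: "v \<in> inverse_ideal ?g" "w \<in> inverse_ideal ?g" "v * X j + w * Y j = 1"
      using h(3) Y[of j] unfolding X_def coprime_over_def by blast
    have "v * X j + (z * w) * X i = 1" using vw(3) z(2) by (simp add: mult_ac)
    then have "coprime_over ?g (X j) (X i)"
      using vw(1) inverse_ideal_mult[OF z(1) vw(2)] unfolding coprime_over_def by blast
    then show ?thesis by (rule coprime_over_sym)
  qed
  show thesis
  proof
    show "\<exists>s\<in>\<aa>. X n = r + s" for n using h(1) Y by (auto simp: X_def)
    show "coprime_over ?g (X i) (X j)" if "i \<noteq> j" for i j
      using cop[of i j] coprime_over_sym[OF cop[of j i]] that by (cases i j rule: linorder_cases) auto
  qed
qed

section \<open>Cosets covered by a collection of ideals\<close>

text \<open>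
  If no member contains \<open>\<gg> = gcd_ideal r \<aa>\<close>, the common cofactor is a value that \<open>d n = b n + \<gg>\<close>
  takes for infinitely many \<open>n\<close>. Unless \<open>\<aa> = {0}\<close> such a value exists, because \<open>\<gg>\<close> lies in only
  finitely many ideals.
\<close>

theorem coset_covered_by_ideals:
  assumes B: "\<And>\<bb>. \<bb> \<in> \<BB> \<Longrightarrow> ideal \<bb> R"
    and D: "common_cofactors R \<BB> = {}"
    and r: "r \<in> A" and a: "ideal \<aa> R" and cover: "\<And>s. s \<in> \<aa> \<Longrightarrow> r + s \<in> \<Union>\<BB>"
  shows "\<exists>\<bb>\<in>\<BB>. gcd_ideal r \<aa> \<subseteq> \<bb>"
proof (cases "\<aa> = {0}")
  case True
  then obtain b where b: "b \<in> \<BB>" "r \<in> b" using cover[of 0] by auto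
  have "gcd_ideal r \<aa> \<subseteq> b"
    using ideal_mult[OF B[OF b(1)] b(2)] True by (auto simp: gcd_ideal_def)
  with b(1) show ?thesis by blast
next
  case False
  let ?g = "gcd_ideal r \<aa>"
  note g = ideal_gcd_ideal[OF a r]
  obtain y where y: "y \<in> \<aa>" "y \<noteq> 0" using False ideal_zero[OF a] by blast
  have yg: "y \<in> ?g" using sub_gcd_ideal y(1) by blast
  show ?thesis
  proof (rule ccontr)
    assume "\<not> ?thesis"
    then have no: "\<not> ?g \<subseteq> b" if "b \<in> \<BB>" for b using that by blast
    obtain X :: "nat \<Rightarrow> 'k" where X: "\<And>n. \<exists>s\<in>\<aa>. X n = r + s"
        and cop: "\<And>i j. i \<noteq> j \<Longrightarrow> coprime_over ?g (X i) (X j)"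
      using ex_pairwise_coprime_sequence[OF a r y] by blast
    have Xg: "X n \<in> ?g" for n using X[of n] coset_sub_gcd_ideal by auto
    have "\<exists>b. b \<in> \<BB> \<and> X n \<in> b" for n using X[of n] cover by fastforce
    then obtain b where b: "\<And>n. b n \<in> \<BB>" "\<And>n. X n \<in> b n" by metis
    note bI = B[OF b(1)]
    define d where "d n = {i + j | i j. i \<in> b n \<and> j \<in> ?g}" for n
    have bd: "b n \<subseteq> d n" for n
      using ideal_zero[OF g] unfolding d_def by force
    have gd: "?g \<subseteq> d n" for n
      using ideal_zero[OF bI] unfolding d_def by force
    have dI: "ideal (d n) R" for n
      unfolding ideal_iff
    proof (intro conjI ballI subsetI)
      show "0 \<in> d n" using gd ideal_zero[OF g] by blast
    next
      fix x assume "x \<in> d n"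
      then show "x \<in> A"
        using ideal_sub[OF bI] ideal_sub[OF g] add_closed unfolding d_def by blast
    next
      fix x x' assume "x \<in> d n" "x' \<in> d n"
      then obtain i j i' j' where
        "x = i + j" "i \<in> b n" "j \<in> ?g" "x' = i' + j'" "i' \<in> b n" "j' \<in> ?g"
        unfolding d_def by blast
      then have "x + x' = (i + i') + (j + j')" "i + i' \<in> b n" "j + j' \<in> ?g"
        using ideal_add[OF bI] ideal_add[OF g] by (simp_all add: algebra_simps)
      then show "x + x' \<in> d n" unfolding d_def by blast
    next
      fix x z assume "x \<in> d n" and z: "z \<in> A"
      then obtain i j where "x = i + j" "i \<in> b n" "j \<in> ?g" unfolding d_def by blast
      then have "z * x = z * i + z * j" "z * i \<in> b n" "z * j \<in> ?g"
        using ideal_mult[OF bI] ideal_mult[OF g] z by (simp_all add: algebra_simps)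
      then show "z * x \<in> d n" unfolding d_def by blast
    qed
    have "finite (range d)"
      by (rule finite_subset[OF _ finite_ideals_containing[OF ideal_sub[OF a y(1)] y(2)]])
        (use dI gd yg in blast)
    then obtain n\<^sub>0 where inf: "infinite {n. d n = d n\<^sub>0}"
      using pigeonhole_infinite[of UNIV d] by auto
    define N where "N = {n. d n = d n\<^sub>0}"
    define c where "c n = ideal_quotient (b n) (d n\<^sub>0)" for n
    have wc: "w * X n \<in> c n" if w: "w \<in> inverse_ideal ?g" and n: "n \<in> N" for w n
      unfolding c_def ideal_quotient_def
    proof (intro CollectI conjI ballI)
      show wX: "w * X n \<in> A" by (rule inverse_idealD[OF w Xg])
      fix e assume "e \<in> d n\<^sub>0"
      then have "e \<in> d n" using n by (simp add: N_def)
      then obtain i j where ij: "e = i + j" "i \<in> b n" "j \<in> ?g" unfolding d_def by blast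
      have "w * X n * e = w * X n * i + w * j * X n" by (simp add: ij(1) algebra_simps)
      also have "\<dots> \<in> b n"
        by (rule ideal_add[OF bI ideal_mult[OF bI ij(2) wX]
              ideal_mult[OF bI b(2) inverse_idealD[OF w ij(3)]]])
      finally show "w * X n * e \<in> b n" .
    qed
    have cI: "ideal (c n) R" for n unfolding c_def by (rule ideal_ideal_quotient[OF bI])
    have one: "\<exists>x\<in>c i. \<exists>x'\<in>c j. x + x' = 1" if "i \<in> N" "j \<in> N" "i \<noteq> j" for i j
      using cop[OF that(3)] wc[OF _ that(1)] wc[OF _ that(2)] unfolding coprime_over_def by blast
    \<comment> \<open>coprime ideals that are equal contain \<open>1\<close>; so properness of the quotients makes them distinct\<close>
    have proper: "1 \<notin> c n" if n: "n \<in> N" for n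
    proof
      assume "1 \<in> c n"
      then have "d n\<^sub>0 \<subseteq> b n" unfolding c_def ideal_quotient_def by auto
      then show False using gd[of n\<^sub>0] no[OF b(1)] by blast
    qed
    have "inj_on c N"
    proof (rule inj_onI, rule ccontr)
      fix i j assume ij: "i \<in> N" "j \<in> N" "c i = c j" "i \<noteq> j"
      then obtain x x' where "x \<in> c i" "x' \<in> c i" "x + x' = 1" using one[of i j] by auto
      then have "1 \<in> c i" using ideal_add[OF cI] by metis
      then show False using proper[OF ij(1)] by blast
    qed
    then have "infinite (c ` N)" using inf finite_imageD unfolding N_def by blast
    moreover have "pairwise_coprime R (c ` N)"
      unfolding pairwise_coprime_def pairwise_def
    proof (intro ballI impI)
      fix C C' assume "C \<in> c ` N" "C' \<in> c ` N" "C \<noteq> C'"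
      then obtain i j where ij: "C = c i" "C' = c j" "i \<in> N" "j \<in> N" "i \<noteq> j" by blast
      obtain x x' where x: "x \<in> c i" "x' \<in> c j" "x + x' = 1" using one[OF ij(3-5)] by blast
      have "z \<in> C <+>\<^bsub>R\<^esub> C'" if "z \<in> A" for z
      proof -
        have "z = z * x + z * x'" using x(3) by (simp flip: distrib_left)
        moreover have "z * x \<in> C" "z * x' \<in> C'"
          using ideal_mult[OF cI] x(1,2) that ij(1,2) by auto
        ultimately show ?thesis unfolding set_add_def' by auto
      qed
      moreover have "C <+>\<^bsub>R\<^esub> C' \<subseteq> A"
        unfolding set_add_def' using ideal_sub[OF cI] add_closed ij(1,2) by auto
      ultimately show "C <+>\<^bsub>R\<^esub> C' = carrier R" by auto
    qed
    moreover have "{d n\<^sub>0 \<cdot>\<^bsub>R\<^esub> C | C. C \<in> c ` N} \<subseteq> \<BB>"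
    proof clarify
      fix n assume n: "n \<in> N"
      then have "b n \<subseteq> d n\<^sub>0" using bd[of n] by (simp add: N_def)
      from to_contain_is_to_divide[OF dI _ y(2) bI this]
      have "d n\<^sub>0 \<cdot>\<^bsub>R\<^esub> c n = b n" using gd yg unfolding c_def by blast
      then show "d n\<^sub>0 \<cdot>\<^bsub>R\<^esub> c n \<in> \<BB>" using b(1) by simp
    qed
    moreover have "d n\<^sub>0 \<noteq> {\<zero>\<^bsub>R\<^esub>}" using gd yg y(2) by auto
    ultimately have "d n\<^sub>0 \<in> common_cofactors R \<BB>"
      using dI cI unfolding common_cofactors_def by blast
    then show False using D by blast
  qed
qed

end

section \<open>Integers of a number field\<close>

lemma clear_denominators:
  fixes u :: "'a \<Rightarrow> rat"
  assumes "finite S"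
  shows "\<exists>d::int. d \<noteq> 0 \<and> (\<forall>s\<in>S. of_int d * u s \<in> \<int>)"
  using assms
proof (induction S rule: finite_induct)
  case empty
  show ?case by (intro exI[of _ 1]) simp
next
  case (insert x S)
  then obtain d where d: "d \<noteq> 0" "\<forall>s\<in>S. of_int d * u s \<in> \<int>" by blast
  obtain a b where ab: "u x = of_int a / of_int b" "b \<noteq> 0"
    using quotient_of_div[of "u x"] quotient_of_denom_pos[of "u x"]
    by (metis less_irrefl surj_pair)
  have "of_int (d * b) * u s \<in> \<int>" if "s \<in> insert x S" for s
  proof (cases "s = x")
    case True
    have "of_int (d * b) * u x = of_int (d * a)" using ab by simp
    then show ?thesis using True by (metis Ints_of_int)
  next
    case False
    then have "of_int d * u s \<in> \<int>" using that d(2) by simp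
    then have "of_int b * (of_int d * u s) \<in> \<int>" by (rule Ints_mult[OF Ints_of_int])
    then show ?thesis by (simp add: mult_ac)
  qed
  then show ?case using d(1) ab(2) by (intro exI[of _ "d * b"]) simp
qed

text \<open>
  Clear denominators and divide by the greatest common divisor.
\<close>

lemma ex_integer_multiple_not_all_divisible:
  fixes u :: "'a \<Rightarrow> rat" and p :: int
  assumes S: "finite S" and v: "v \<in> S" "u v \<noteq> 0" and p: "prime p"
  obtains c :: "'a \<Rightarrow> int" and k :: rat
  where "\<And>s. s \<in> S \<Longrightarrow> of_int (c s) = k * u s" "\<exists>s\<in>S. \<not> p dvd c s"
proof -
  obtain d :: int where d: "d \<noteq> 0" "\<forall>s\<in>S. of_int d * u s \<in> \<int>"
    using clear_denominators[OF S] by blast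
  define b where "b s = \<lfloor>of_int d * u s\<rfloor>" for s
  have b: "of_int (b s) = of_int d * u s" if "s \<in> S" for s
    using d(2) that by (simp add: b_def)
  define G where "G = Gcd (b ` S)"
  have "b v \<noteq> 0" using b[OF v(1)] v(2) d(1) by auto
  then have G: "G \<noteq> 0" unfolding G_def using v(1) by (auto simp: Gcd_0_iff)
  have Gb: "b s = G * (b s div G)" if "s \<in> S" for s
    using that unfolding G_def by simp
  have not_all: "\<exists>s\<in>S. \<not> p dvd b s div G"
  proof (rule ccontr)
    assume "\<not> ?thesis"
    then have dvd: "p dvd b s div G" if "s \<in> S" for s using that by blast
    have "G * p dvd b s" if s: "s \<in> S" for s
      using mult_dvd_mono[OF dvd_refl[of G] dvd[OF s]] unfolding Gb[OF s, symmetric] .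
    then have "G * p dvd Gcd (b ` S)" by (intro Gcd_greatest) auto
    then have "G * p dvd G" by (simp only: G_def)
    then show False using G p by (simp add: not_prime_unit)
  qed
  have "of_int (b s div G) = (of_int d / of_int G) * u s" if "s \<in> S" for s
  proof -
    have "(of_int d * u s :: rat) = of_int (G * (b s div G))"
      using Gb[OF that, symmetric] b[OF that, symmetric] by (simp only:)
    then show ?thesis using G by (simp add: field_simps)
  qed
  from this not_all show thesis
    by (rule that[of "\<lambda>s. b s div G" "of_int d / of_int G"])
qed

text \<open>
  Call a finite set \<open>S \<subseteq> A\<close> independent modulo \<open>p\<close> if an integer combination of \<open>S\<close> lies in
  \<open>p * A\<close> only when \<open>p\<close> divides all coefficients. Such a set is linearly independent over the
  rationals, because a linear relation can be scaled to integer coefficients not all divisible by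
  \<open>p\<close>; so its size is at most the dimension. A largest such set spans \<open>A\<close> modulo \<open>p\<close>, and reducing
  the coefficients modulo \<open>p\<close> leaves finitely many combinations.
\<close>

lemma finite_residues_prime:
  fixes A :: "'k::field_char_0 set"
  assumes dim: "finite_dimensional_vector_space (\<lambda>(q::rat) (x::'k). of_rat q * x) Basis"
    and zero: "0 \<in> A" and diff: "\<And>x y. x \<in> A \<Longrightarrow> y \<in> A \<Longrightarrow> x - y \<in> A"
    and p: "prime (p::int)"
  shows "\<exists>F. finite F \<and> (\<forall>x\<in>A. \<exists>f\<in>F. (x - f) / of_int p \<in> A)"
proof -
  interpret V: finite_dimensional_vector_space "\<lambda>(q::rat) (x::'k). of_rat q * x" Basis
    by (rule dim)
  have p0: "p \<noteq> 0" using p by auto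
  have uminus: "- x \<in> A" if "x \<in> A" for x using diff[OF zero that] by simp
  have add: "x + y \<in> A" if "x \<in> A" "y \<in> A" for x y using diff[OF that(1) uminus[OF that(2)]] by simp
  have int_mult: "of_int n * x \<in> A" if x: "x \<in> A" for n x
  proof (induction n rule: int_induct[of _ 0])
    case (step1 i)
    then show ?case using add[OF _ x] by (simp add: distrib_right)
  next
    case (step2 i)
    then show ?case using diff[OF _ x] by (simp add: left_diff_distrib)
  qed (simp add: zero)
  define comb where "comb S c = (\<Sum>s\<in>S. of_int (c s) * s)" for S and c :: "'k \<Rightarrow> int"
  have comb_A: "comb S c \<in> A" if "finite S" "S \<subseteq> A" for S c
    using that by (induction S rule: finite_induct) (auto simp: comb_def zero add int_mult)
  define indep where "indep S \<longleftrightarrow> finite S \<and> S \<subseteq> A \<and>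
    (\<forall>c. comb S c / of_int p \<in> A \<longrightarrow> (\<forall>s\<in>S. p dvd c s))" for S
  have card: "card S \<le> card Basis" if S: "indep S" for S
  proof -
    have fin: "finite S" using S by (simp add: indep_def)
    have "V.independent S"
    proof
      assume "V.dependent S"
      then obtain u v where uv: "v \<in> S" "u v \<noteq> 0" "(\<Sum>s\<in>S. of_rat (u s) * s) = 0"
        using V.dependent_finite[OF fin] by blast
      obtain c :: "'k \<Rightarrow> int" and k where
        c: "\<And>s. s \<in> S \<Longrightarrow> of_int (c s) = k * u s" "\<exists>s\<in>S. \<not> p dvd c s"
        using ex_integer_multiple_not_all_divisible[of S v u p] fin uv(1,2) p by metis
      have "of_int (c s) = (of_rat k * of_rat (u s) :: 'k)" if "s \<in> S" for s
        using arg_cong[OF c(1)[OF that], of "of_rat :: rat \<Rightarrow> 'k"] by (simp add: of_rat_mult)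
      then have "comb S c = of_rat k * (\<Sum>s\<in>S. of_rat (u s) * s)"
        unfolding comb_def sum_distrib_left by (intro sum.cong) (simp_all add: mult.assoc)
      then have "comb S c / of_int p \<in> A" using uv(3) zero by simp
      then show False using S c(2) by (auto simp: indep_def)
    qed
    then show ?thesis
      using V.independent_span_bound[OF V.finite_Basis, of S] by (simp add: V.span_Basis)
  qed
  have "indep {}" by (simp add: indep_def)
  then have "\<exists>S. indep S \<and> (\<forall>T. indep T \<longrightarrow> card T \<le> card S)"
    by (rule ex_has_greatest_nat[of indep "{}" card "Suc (card Basis)"]) (simp add: card less_Suc_eq_le)
  then obtain S where S: "indep S" and max: "\<And>T. indep T \<Longrightarrow> card T \<le> card S"
    by blast
  have fin: "finite S" and SA: "S \<subseteq> A"
    and ind: "\<And>c s. comb S c / of_int p \<in> A \<Longrightarrow> s \<in> S \<Longrightarrow> p dvd c s"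
    using S by (auto simp: indep_def)
  have span: "\<exists>c. (x - comb S c) / of_int p \<in> A" if x: "x \<in> A" for x
  proof (cases "x \<in> S")
    case True
    have "comb S (\<lambda>s. if s = x then 1 else 0) = (\<Sum>s\<in>S. if s = x then x else 0)"
      unfolding comb_def by (intro sum.cong) auto
    also have "\<dots> = x" using True fin by simp
    finally show ?thesis using zero by (intro exI[of _ "\<lambda>s. if s = x then 1 else 0"]) simp
  next
    case False
    then have "\<not> indep (insert x S)" using max[of "insert x S"] fin by auto
    then obtain c where c: "comb (insert x S) c / of_int p \<in> A" "\<exists>s\<in>insert x S. \<not> p dvd c s"
      using fin SA x by (auto simp: indep_def)
    have split: "comb (insert x S) c = of_int (c x) * x + comb S c"
      using False fin by (simp add: comb_def)
    have "\<not> p dvd c x"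
    proof
      assume dvd: "p dvd c x"
      then obtain k where k: "c x = p * k" by (rule dvdE)
      have "comb S c / of_int p = comb (insert x S) c / of_int p - of_int k * x"
        unfolding split using p0 by (simp add: k field_simps)
      then have "comb S c / of_int p \<in> A" using diff[OF c(1) int_mult[OF x]] by simp
      then show False using ind c(2) dvd by blast
    qed
    then have "coprime (c x) p" using p prime_imp_coprime coprime_commute by blast
    then obtain a b where ab: "a * c x + b * p = 1"
      using bezout_int[of "c x" p] by (auto simp: coprime_iff_gcd_eq_1)
    \<comment> \<open>\<open>a\<close> inverts the coefficient of \<open>x\<close> modulo \<open>p\<close>, which solves the relation for \<open>x\<close>\<close>
    have "x = of_int (a * c x + b * p) * x" by (simp add: ab)
    then have x_eq: "x = of_int a * (of_int (c x) * x) + of_int p * (of_int b * x)"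
      by (simp add: algebra_simps)
    have "comb S (\<lambda>s. - a * c s) = - of_int a * comb S c"
      unfolding comb_def sum_distrib_left by (intro sum.cong) (simp_all add: mult.assoc)
    then have "x - comb S (\<lambda>s. - a * c s)
        = of_int a * comb (insert x S) c + of_int p * (of_int b * x)"
      unfolding split by (subst x_eq) (simp add: algebra_simps)
    then have "(x - comb S (\<lambda>s. - a * c s)) / of_int p
        = of_int a * (comb (insert x S) c / of_int p) + of_int b * x"
      using p0 by (simp add: field_simps)
    also have "\<dots> \<in> A" by (intro add int_mult c x)
    finally show ?thesis by blast
  qed
  let ?F = "comb S ` (S \<rightarrow>\<^sub>E {0..<p})"
  have "\<exists>f\<in>?F. (x - f) / of_int p \<in> A" if x: "x \<in> A" for x
  proof -
    obtain c where c: "(x - comb S c) / of_int p \<in> A" using span[OF x] by blast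
    define c' where "c' = (\<lambda>s\<in>S. c s mod p)"
    have "c' \<in> S \<rightarrow>\<^sub>E {0..<p}"
      using p prime_gt_0_int[OF p] by (auto simp: c'_def)
    moreover have "comb S c = of_int p * comb S (\<lambda>s. c s div p) + comb S c'"
      unfolding comb_def sum_distrib_left sum.distrib[symmetric]
    proof (rule sum.cong[OF refl])
      fix s assume "s \<in> S"
      have "(of_int (c s) :: 'k) = of_int (p * (c s div p) + c s mod p)" by simp
      also have "\<dots> = of_int p * of_int (c s div p) + of_int (c' s)"
        using \<open>s \<in> S\<close> by (simp only: of_int_add of_int_mult c'_def restrict_apply if_True)
      finally show "of_int (c s) * s = of_int p * (of_int (c s div p) * s) + of_int (c' s) * s"
        by (simp add: algebra_simps)
    qed
    then have "(x - comb S c') / of_int p = (x - comb S c) / of_int p + comb S (\<lambda>s. c s div p)"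
      using p0 by (simp add: field_simps)
    then have "(x - comb S c') / of_int p \<in> A" using add[OF c comb_A[OF fin SA]] by simp
    ultimately show ?thesis by blast
  qed
  moreover have "finite ?F" using fin by (intro finite_imageI finite_PiE) auto
  ultimately show ?thesis by blast
qed

text \<open>
  Residues modulo \<open>p * k\<close> are residues modulo \<open>p\<close> plus \<open>p\<close> times residues modulo \<open>k\<close>.
\<close>

lemma finite_residues_nat:
  fixes A :: "'k::field_char_0 set"
  assumes dim: "finite_dimensional_vector_space (\<lambda>(q::rat) (x::'k). of_rat q * x) Basis"
    and zero: "0 \<in> A" and diff: "\<And>x y. x \<in> A \<Longrightarrow> y \<in> A \<Longrightarrow> x - y \<in> A"
    and n: "n > 0"
  shows "\<exists>F. finite F \<and> (\<forall>x\<in>A. \<exists>f\<in>F. (x - f) / of_nat n \<in> A)"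
  using n
proof (induction n rule: less_induct)
  case (less n)
  show ?case
  proof (cases "n = 1")
    case True
    then show ?thesis by (intro exI[of _ "{0}"]) auto
  next
    case False
    then obtain p where p: "prime p" "p dvd n" using prime_factor_nat by blast
    then obtain k where k: "n = p * k" by blast
    have "k < n" "k > 0" using k less.prems prime_gt_1_nat[OF p(1)] by auto
    then obtain F where F: "finite F" "\<forall>x\<in>A. \<exists>f\<in>F. (x - f) / of_nat k \<in> A"
      using less.IH by blast
    have "prime (int p)" using p(1) by simp
    from finite_residues_prime[OF dim zero diff this]
    obtain E where E: "finite E" "\<forall>x\<in>A. \<exists>f\<in>E. (x - f) / of_int (int p) \<in> A" by blast
    have "\<exists>f\<in>(\<lambda>(e, f). e + of_nat p * f) ` (E \<times> F). (x - f) / of_nat n \<in> A" if x: "x \<in> A" for x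
    proof -
      obtain e where e: "e \<in> E" "(x - e) / of_nat p \<in> A" using E(2) x by auto
      obtain f where f: "f \<in> F" "((x - e) / of_nat p - f) / of_nat k \<in> A" using F(2) e(2) by blast
      have "(x - (e + of_nat p * f)) / of_nat n = ((x - e) / of_nat p - f) / of_nat k"
        using less.prems by (simp add: k field_simps)
      moreover have "e + of_nat p * f \<in> (\<lambda>(e, f). e + of_nat p * f) ` (E \<times> F)"
        using e(1) f(1) by (intro image_eqI[of _ _ "(e, f)"]) simp_all
      ultimately show ?thesis using f(2) by (intro bexI[of _ "e + of_nat p * f"]) simp_all
    qed
    moreover have "finite ((\<lambda>(e, f). e + of_nat p * f) ` (E \<times> F))" using E(1) F(1) by simp
    ultimately show ?thesis by blast
  qed
qed

lemma algebraic_int_of_power_diff: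
  fixes x :: "'k::field_char_0"
  assumes "j < k" "algebraic_int (x ^ k - x ^ j)"
  shows "algebraic_int x"
proof (rule algebraic_int_root[OF assms(2)])
  let ?p = "monom 1 k - monom 1 j :: 'k poly"
  have deg: "degree ?p = k"
  proof -
    have "degree ?p = degree (monom (1 :: 'k) k)"
      using assms(1) degree_add_eq_left[of "- monom 1 j" "monom 1 k :: 'k poly"]
      by (simp add: degree_monom_eq)
    then show ?thesis by (simp add: degree_monom_eq)
  qed
  show "poly ?p x = x ^ k - x ^ j" by (simp add: poly_monom)
  show "\<forall>i. coeff ?p i \<in> \<int>" by simp
  show "lead_coeff ?p = 1" using assms(1) unfolding deg by simp
  show "degree ?p > 0" using assms(1) unfolding deg by simp
qed

text \<open>
  After cancelling powers of \<open>y\<close>, the constant term \<open>n\<close> of \<open>q\<close> is nonzero, and the equation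
  \<open>q y = 0\<close> exhibits \<open>n\<close> as a multiple of \<open>y\<close>.
\<close>

lemma ex_integer_multiple_in_subring:
  fixes A :: "'k::field_char_0 set"
  assumes A: "\<And>n. of_int n \<in> A" "\<And>x y. x \<in> A \<Longrightarrow> y \<in> A \<Longrightarrow> x + y \<in> A"
      "\<And>x y. x \<in> A \<Longrightarrow> y \<in> A \<Longrightarrow> x * y \<in> A"
    and y: "y \<in> A" "y \<noteq> 0"
    and q: "q \<noteq> 0" "poly (map_poly of_int q) y = 0"
  shows "\<exists>n::int. n \<noteq> 0 \<and> of_int n / y \<in> A"
  using q
proof (induction q)
  case (pCons a q)
  have *: "of_int a + y * poly (map_poly of_int q) y = 0"
    using pCons.prems(2) by (simp add: map_poly_pCons)
  show ?case
  proof (cases "a = 0")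
    case True
    then show ?thesis using * pCons y(2) by auto
  next
    case False
    have "poly (map_poly of_int q) y \<in> A" for q
    proof (induction q)
      case 0
      then show ?case using A(1)[of 0] by simp
    next
      case (pCons a q)
      then show ?case using A y(1) by (simp add: map_poly_pCons)
    qed
    then have "of_int (-1) * poly (map_poly of_int q) y \<in> A" using A(1,3) by blast
    moreover have "of_int a / y = of_int (-1) * poly (map_poly of_int q) y"
      using * y(2) by (simp add: field_simps add_eq_0_iff)
    ultimately show ?thesis using False by auto
  qed
qed simp

text \<open>
  A nonzero algebraic integer \<open>m\<close> divides a positive integer \<open>N\<close>, and residues modulo \<open>N\<close> are fine
  enough to represent all residues modulo \<open>m\<close>. Closure of the algebraic integers under addition
  and multiplication is taken from the second hypothesis.
\<close>

lemma integers_of_number_field: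
  assumes nf: "number_field TYPE('k::field_char_0)"
    and ring: "ring (ring_of_integers :: 'k ring)"
  shows "integrally_closed_finite_quotients {x::'k. algebraic_int x}"
proof -
  interpret OK: ring "ring_of_integers :: 'k ring" by (rule ring)
  have add: "algebraic_int (x + y)" if "algebraic_int x" "algebraic_int y" for x y :: 'k
    using OK.a_closed[of x y] that by (simp add: ring_of_integers_def)
  have mult: "algebraic_int (x * y)" if "algebraic_int x" "algebraic_int y" for x y :: 'k
    using OK.m_closed[of x y] that by (simp add: ring_of_integers_def)
  have diff: "algebraic_int (x - y)" if "algebraic_int x" "algebraic_int y" for x y :: 'k
    using add[OF that(1) algebraic_int_minus[OF that(2)]] by simp
  obtain Basis where dim: "finite_dimensional_vector_space (\<lambda>(q::rat) (x::'k). of_rat q * x) Basis"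
    using nf by (auto simp: number_field_def)
  show ?thesis
  proof
    fix m :: 'k assume m: "m \<in> {x. algebraic_int x}" "m \<noteq> 0"
    then obtain q where q: "poly (map_poly of_int q) m = 0" "lead_coeff q = 1"
      by (auto simp: algebraic_int_altdef_ipoly)
    then have "q \<noteq> 0" by auto
    then obtain n :: int where n: "n \<noteq> 0" "of_int n / m \<in> {x. algebraic_int x}"
      using ex_integer_multiple_in_subring[of "{x. algebraic_int x}" m q] m q(1) add mult by auto
    define N where "N = nat \<bar>n\<bar>"
    have N: "N > 0" "(of_nat N :: 'k) = of_int (sgn n) * of_int n"
      using n(1) by (simp_all add: N_def sgn_if)
    have "algebraic_int (of_int (sgn n) * (of_int n / m))"
      using n(2) by (intro mult) auto
    then have z: "algebraic_int (of_nat N / m)"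
      by (simp add: N(2))
    obtain F where F: "finite F" "\<forall>x\<in>{x::'k. algebraic_int x}. \<exists>f\<in>F. (x - f) / of_nat N \<in> {x. algebraic_int x}"
      using finite_residues_nat[OF dim _ _ N(1), of "{x. algebraic_int x}"] diff by auto
    have "\<exists>f\<in>F. algebraic_int ((x - f) / m)" if x: "algebraic_int x" for x
    proof -
      obtain f where f: "f \<in> F" "algebraic_int ((x - f) / of_nat N)"
        using F(2) x by auto
      have "(x - f) / m = (x - f) / of_nat N * (of_nat N / m)"
        using N(1) by simp
      then show ?thesis using mult[OF f(2) z] f(1) by auto
    qed
    then show "\<exists>F. finite F \<and> (\<forall>x\<in>{x. algebraic_int x}. \<exists>f\<in>F. (x - f) / m \<in> {x. algebraic_int x})"
      using F(1) by auto
  qed (auto intro: diff mult algebraic_int_of_power_diff)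
qed

text \<open>
  That the algebraic integers form a ring is part of the hypothesis that \<open>\<aa>\<close> is an ideal, as the
  locale \<open>ideal\<close> extends \<open>ring\<close>.
\<close>

theorem theorem6:
  fixes OK :: "'k::field_char_0 ring"
    and \<BB> :: "'k set set" and r :: 'k and \<aa> :: "'k set"
  defines "OK \<equiv> ring_of_integers"
  assumes "number_field TYPE('k)"
    and "\<And>\<bb>. \<bb> \<in> \<BB> \<Longrightarrow> ideal \<bb> OK \<and> \<bb> \<noteq> {\<zero>\<^bsub>OK\<^esub>}"
    and "primitive_collection \<BB>"
    and "common_cofactors OK \<BB> = {}"
    and "r \<in> carrier OK"
    and "ideal \<aa> OK"
    and "r <+\<^bsub>OK\<^esub> \<aa> \<subseteq> \<Union>\<BB>"
  shows "\<exists>\<bb>\<in>\<BB>. PIdl\<^bsub>OK\<^esub> r <+>\<^bsub>OK\<^esub> \<aa> \<subseteq> \<bb>"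
proof -
  have "ring (ring_of_integers :: 'k ring)"
    using assms(7) unfolding OK_def by (rule ideal.axioms(2))
  then interpret O: integrally_closed_finite_quotients "{x::'k. algebraic_int x}"
    by (rule integers_of_number_field[OF assms(2)])
  have OK: "OK = O.R" by (simp add: OK_def ring_of_integers_def)
  have "PIdl\<^bsub>OK\<^esub> r <+>\<^bsub>OK\<^esub> \<aa> = O.gcd_ideal r \<aa>"
    unfolding OK cgenideal_def set_add_def' O.gcd_ideal_def by auto
  moreover have "\<exists>\<bb>\<in>\<BB>. O.gcd_ideal r \<aa> \<subseteq> \<bb>"
  proof (rule O.coset_covered_by_ideals)
    fix s assume "s \<in> \<aa>"
    then show "r + s \<in> \<Union>\<BB>" using assms(8) unfolding OK a_l_coset_def' by auto
  qed (use assms(3,5,6,7) in \<open>simp_all add: OK\<close>)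
  ultimately show ?thesis by simp
qed

end
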